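(* Let $X_*\in\mathbb{O}^{n\times k}$, let $X_*^{T}D=U\Sigma V^{T}$ be the SVD of $X_*^{T}D$, where $U,V\in\mathbb{O}^{k\times k}$ and $$\Sigma=\mathrm{diag}(\mu_1I_{k_1},\ldots,\mu_{t}I_{k_t}),\qquad \mu_1>\cdots>\mu_{t-1}>\mu_t\ge 0,\quad \sum_{i=1}^t k_i=k,$$ and let $r=\mathrm{rank}(X_*^{T}D)$. Then for any maximizer $Q_{\mathrm{opt}}$ of $\max_{Q\in\mathbb{O}^{k\times k}} f_\theta(X_*Q)$, $$X_*Q_{\mathrm{opt}}=X_*U_{(:,1:r)}V_{(:,1:r)}^{T}+X_*U_{(:,r+1:k)}WV_{(:,r+1:k)}^{T},$$ in which the first term $X_*U_{(:,1:r)}V_{(:,1:r)}^{T}$ has rank $r$, and the second term has rank $k-r$ and a freedom in $W\in\mathbb{O}^{(k-r)\times(k-r)}$ (i.e., $W$ is an arbitrary element of $\mathbb{O}^{(k-r)\times(k-r)}$). Moreover, $$[X_*Q_{\mathrm{opt}}]^{T}D=V\Sigma V^{T}\succeq 0,\qquad \mathrm{trace}([X_*Q_{\mathrm{opt}}]^{T}D)=\|X_*^{T}D\|_{\mathrm{trace}}.$$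
   Context: Standing setting: $1\le k<n$; $A,B\in\mathbb{R}^{n\times n}$ are symmetric, $B$ is positive semidefinite with $\mathrm{rank}(B)>n-k$; $D\in\mathbb{R}^{n\times k}$; $0\le\theta\le 1$. $\mathbb{O}^{p\times q}=\{X\in\mathbb{R}^{p\times q}: X^{T}X=I_q\}$. For $X\in\mathbb{O}^{n\times k}$, $f_\theta(X)=\mathrm{trace}(X^{T}AX+X^{T}D)/[\mathrm{trace}(X^{T}BX)]^{\theta}$. $M_{(:,i:j)}$ denotes the submatrix of columns $i$ through $j$ of $M$. $\|M\|_{\mathrm{trace}}$ is the trace (nuclear) norm, the sum of the singular values of $M$. $M\succeq0$ means symmetric positive semidefinite. If $r=k$, then $W$ is a null matrix and the second term is absent. *)

theory Defs
  imports Complex_Main "Jordan_Normal_Form.DL_Rank" "Jordan_Normal_Form.Char_Poly"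
begin

definition stiefel :: "nat \<Rightarrow> nat \<Rightarrow> real mat set" where
  "stiefel p q = {X \<in> carrier_mat p q. transpose_mat X * X = 1\<^sub>m q}"

definition symmetric_mat :: "real mat \<Rightarrow> bool" where
  "symmetric_mat M \<longleftrightarrow> square_mat M \<and> transpose_mat M = M"

definition psd_mat :: "real mat \<Rightarrow> bool" where
  "psd_mat M \<longleftrightarrow>
     symmetric_mat M \<and> (\<forall>v \<in> carrier_vec (dim_row M). 0 \<le> v \<bullet> (M *\<^sub>v v))"

definition mat_trace :: "real mat \<Rightarrow> real" where
  "mat_trace M = (\<Sum>i<dim_row M. M $$ (i, i))"

text \<open>
  The rank in the library depends on the number of rows of the matrix as a separate parameter;
  it is filled in here.
\<close>

definition mat_rank :: "real mat \<Rightarrow> nat" where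
  "mat_rank M = vec_space.rank (dim_row M) M"

text \<open>
  The multiset has \<open>dim_col M\<close> elements (for a real symmetric matrix the characteristic
  polynomial splits over the reals), so a matrix with more columns than rows gets additional
  zeros compared with the convention of \<open>min (dim_row M) (dim_col M)\<close> singular values.
  This does not affect their sum.
\<close>

definition singular_values :: "real mat \<Rightarrow> real multiset" where
  "singular_values M = image_mset sqrt (proots (char_poly (transpose_mat M * M)))"

definition trace_norm :: "real mat \<Rightarrow> real" where
  "trace_norm M = sum_mset (singular_values M)"

text \<open>
  The submatrix of columns \<open>i\<close> through \<open>j\<close>, both inclusive and counted from 1
  (whereas \<^const>\<open>col\<close> counts from 0); it has no columns if \<open>j < i\<close>.
\<close>

definition cols_range :: "real mat \<Rightarrow> nat \<Rightarrow> nat \<Rightarrow> real mat" where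
  "cols_range M i j = mat_of_cols (dim_row M) (map (\<lambda>l. col M (l - 1)) [i..<Suc j])"

text \<open>\<open>diag (\<mu>\<^sub>1 I, \<dots>, \<mu>\<^sub>t I)\<close>, where the \<open>i\<close>-th identity block has size \<open>m i\<close>.\<close>

definition block_diag :: "nat \<Rightarrow> (nat \<Rightarrow> real) \<Rightarrow> (nat \<Rightarrow> nat) \<Rightarrow> real mat" where
  "block_diag t \<mu> m = diag_block_mat (map (\<lambda>i. \<mu> i \<cdot>\<^sub>m 1\<^sub>m (m i)) [1..<Suc t])"

definition f_theta :: "real mat \<Rightarrow> real mat \<Rightarrow> real mat \<Rightarrow> real \<Rightarrow> real mat \<Rightarrow> real" where
  "f_theta A B D \<theta> X =
     mat_trace (transpose_mat X * A * X + transpose_mat X * D)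
       / mat_trace (transpose_mat X * B * X) powr \<theta>"

end

theory Submission
  imports Defs
begin

text \<open>
Replacing \<open>X\<close> by \<open>X Q\<close> with \<open>Q\<close> orthogonal leaves the traces of \<open>X\<^sup>T A X\<close> and
\<open>X\<^sup>T B X\<close> unchanged (\<open>f_theta_mult_orthogonal\<close>). The denominator is moreover positive: if
\<open>trace (X\<^sup>T B X)\<close> vanished, then semidefiniteness would give \<open>B X = 0\<close>, so that \<open>B\<close> kills \<open>k\<close>
independent vectors and has rank at most \<open>n - k\<close> (\<open>mat_trace_quadratic_pos\<close>). Hence maximizing
\<open>f\<^sub>\<theta> (X Q)\<close> over \<open>Q\<close> means maximizing \<open>trace (Q\<^sup>T M)\<close> for \<open>M = X\<^sup>T D = U \<Sigma> V\<^sup>T\<close>, an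
orthogonal Procrustes problem.

In terms of the orthogonal matrix \<open>P = U\<^sup>T Q V\<close>, that trace is \<open>\<Sum>i. \<sigma>\<^sub>i P\<^sub>i\<^sub>i\<close>
(\<open>mat_trace_rotated_svd\<close>). No entry of \<open>P\<close> exceeds 1, so the maximum is \<open>\<Sum>i. \<sigma>\<^sub>i\<close>, and it is
attained exactly if \<open>P\<^sub>i\<^sub>i = 1\<close> wherever \<open>\<sigma>\<^sub>i > 0\<close>, that is for the first \<open>r\<close> indices. A diagonal
entry 1 forces the rest of its row and column to vanish, so \<open>P\<close> is the block sum of
\<open>I\<^sub>r\<close> and an orthogonal \<open>W\<close> (\<open>sum_diagonal_stiefel_eq_imp_id_oplus\<close>). Multiplying out
\<open>Q = U P V\<^sup>T\<close> by column blocks gives the stated decomposition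
(\<open>mult_id_oplus_mult_transpose\<close>), every \<open>W\<close> occurs, and \<open>Q\<^sup>T M = V P\<^sup>T \<Sigma> V\<^sup>T = V \<Sigma> V\<^sup>T\<close>.

The three rank claims, including \<open>r\<close> being the number of positive \<open>\<sigma>\<^sub>i\<close>, come from one criterion
(\<open>mat_rank_eqI\<close>): if each of \<open>M\<close> and \<open>Y\<close> is a right multiple of the other and \<open>Y\<close> has \<open>p\<close>
orthonormal columns, then \<open>M\<close> has rank \<open>p\<close>.
\<close>

section \<open>Matrices with orthonormal columns\<close>

lemma stiefelD:
  assumes "Y \<in> stiefel n p"
  shows "Y \<in> carrier_mat n p" and "Y\<^sup>T * Y = 1\<^sub>m p"
  using assms by (auto simp: stiefel_def)

lemma stiefelI: "Y \<in> carrier_mat n p \<Longrightarrow> Y\<^sup>T * Y = 1\<^sub>m p \<Longrightarrow> Y \<in> stiefel n p"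
  by (auto simp: stiefel_def)

lemma stiefel_cancel:
  assumes "Y \<in> stiefel n p" and "Z \<in> carrier_mat p q"
  shows "Y\<^sup>T * (Y * Z) = Z"
proof -
  note Y = stiefelD[OF assms(1)]
  have "Y\<^sup>T * (Y * Z) = (Y\<^sup>T * Y) * Z"
    using Y(1) assms(2) by simp
  with Y(2) assms(2) show ?thesis by simp
qed

lemma stiefel_mult:
  assumes "Y \<in> stiefel n p" and "Z \<in> stiefel p q"
  shows "Y * Z \<in> stiefel n q"
proof (rule stiefelI)
  note Y = stiefelD[OF assms(1)] and Z = stiefelD[OF assms(2)]
  show "Y * Z \<in> carrier_mat n q" using Y Z by simp
  have "(Y * Z)\<^sup>T * (Y * Z) = Z\<^sup>T * (Y\<^sup>T * (Y * Z))"
    using Y(1) Z(1) by (simp add: transpose_mult[OF Y(1) Z(1)] assoc_mult_mat[of _ q p _ n _ q])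
  then show "(Y * Z)\<^sup>T * (Y * Z) = 1\<^sub>m q"
    using stiefel_cancel[OF assms(1) Z(1)] Z(2) by simp
qed

text \<open>
For a square matrix a left inverse is a right inverse, so orthonormal columns mean orthonormal rows.
\<close>

lemma stiefel_square_right_inverse:
  assumes "Q \<in> stiefel k k"
  shows "Q * Q\<^sup>T = 1\<^sub>m k"
  using mat_mult_left_right_inverse[of "Q\<^sup>T" k Q] stiefelD[OF assms] by simp

lemma stiefel_square_transpose: "Q \<in> stiefel k k \<Longrightarrow> Q\<^sup>T \<in> stiefel k k"
  using stiefel_square_right_inverse[of Q k] stiefelD[of Q k k] by (auto intro!: stiefelI)

lemma stiefel_sum_col:
  assumes "Y \<in> stiefel n p" and "i < p" and "j < p"
  shows "(\<Sum>l<n. Y $$ (l, i) * Y $$ (l, j)) = (if i = j then 1 else 0)"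
proof -
  note Y = stiefelD[OF assms(1)]
  have "(Y\<^sup>T * Y) $$ (i, j) = (\<Sum>l<n. Y $$ (l, i) * Y $$ (l, j))"
    using Y(1) assms(2,3) by (simp add: scalar_prod_def atLeast0LessThan)
  with Y(2) assms(2,3) show ?thesis by simp
qed

text \<open>
The squares of the entries of a column add up to 1. This bounds each entry, and an entry equal
to 1 leaves nothing for the others.
\<close>

lemma stiefel_entry_le_1:
  assumes "Y \<in> stiefel n p" and "i < n" and "j < p"
  shows "Y $$ (i, j) \<le> 1"
proof -
  have "Y $$ (i, j) * Y $$ (i, j) \<le> (\<Sum>l<n. Y $$ (l, j) * Y $$ (l, j))"
    using assms(2) by (intro member_le_sum) auto
  also have "\<dots> = 1" using stiefel_sum_col[OF assms(1,3,3)] by simp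
  finally show ?thesis by (metis abs_le_square_iff abs_le_D1 abs_one mult_1 power2_eq_square)
qed

lemma stiefel_entry_1_imp_0:
  assumes "Y \<in> stiefel n p" and "i < n" and "j < p" and "Y $$ (i, j) = 1"
    and "l < n" and "l \<noteq> i"
  shows "Y $$ (l, j) = 0"
proof -
  have "1 + Y $$ (l, j) * Y $$ (l, j) = (\<Sum>l\<in>{i, l}. Y $$ (l, j) * Y $$ (l, j))"
    using assms(4,6) by simp
  also have "\<dots> \<le> (\<Sum>l<n. Y $$ (l, j) * Y $$ (l, j))"
    using assms(2,5) by (intro sum_mono2) auto
  also have "\<dots> = 1" using stiefel_sum_col[OF assms(1,3,3)] by simp
  finally have "Y $$ (l, j) * Y $$ (l, j) \<le> 0" by simp
  then show ?thesis using zero_le_square[of "Y $$ (l, j)"] by (metis antisym mult_eq_0_iff)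
qed

section \<open>Trace\<close>

lemma mat_trace_mult:
  assumes "G \<in> carrier_mat n p" and "H \<in> carrier_mat p n"
  shows "mat_trace (G * H) = (\<Sum>i<n. \<Sum>j<p. G $$ (i, j) * H $$ (j, i))"
  using assms by (auto simp: mat_trace_def scalar_prod_def atLeast0LessThan intro!: sum.cong)

lemma mat_trace_comm:
  assumes "G \<in> carrier_mat n p" and "H \<in> carrier_mat p n"
  shows "mat_trace (G * H) = mat_trace (H * G)"
  unfolding mat_trace_mult[OF assms] mat_trace_mult[OF assms(2,1)]
  by (subst sum.swap) (simp add: mult.commute)

lemma mat_trace_add:
  assumes "G \<in> carrier_mat n n" and "H \<in> carrier_mat n n"
  shows "mat_trace (G + H) = mat_trace G + mat_trace H"
  using assms by (simp add: mat_trace_def sum.distrib)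

lemma mat_trace_conj:
  assumes "Q \<in> stiefel k k" and "G \<in> carrier_mat k k"
  shows "mat_trace (Q\<^sup>T * G * Q) = mat_trace G"
proof -
  note Q = stiefelD[OF assms(1)]
  have "mat_trace (Q\<^sup>T * G * Q) = mat_trace (Q * (Q\<^sup>T * G))"
    using Q(1) assms(2) by (intro mat_trace_comm) auto
  also have "Q * (Q\<^sup>T * G) = Q * Q\<^sup>T * G"
    using Q(1) assms(2) by simp
  finally show ?thesis
    using stiefel_square_right_inverse[OF assms(1)] assms(2) by simp
qed

section \<open>Rank\<close>

text \<open>
The column space of \<open>G * H\<close> lies in that of \<open>G\<close>.
\<close>

lemma mat_rank_mult_le:
  assumes "G \<in> carrier_mat n p" and "H \<in> carrier_mat p q"
  shows "mat_rank (G * H) \<le> mat_rank G"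
proof -
  interpret vec_space "TYPE(real)" n .
  have GH: "G * H \<in> carrier_mat n q" using assms by simp
  let ?S = "span (set (cols G))" and ?R = "span (set (cols (G * H)))"
  have cG: "set (cols G) \<subseteq> carrier_vec n" and cGH: "set (cols (G * H)) \<subseteq> carrier_vec n"
    using cols_dim[of G] cols_dim[of "G * H"] assms by auto
  have "?R \<subseteq> ?S"
  proof
    fix y assume "y \<in> ?R"
    then obtain x where x: "x \<in> carrier_vec q" "y = G * H *\<^sub>v x"
      using col_space_eq[OF GH] GH unfolding col_space_def by auto
    then have "y = G *\<^sub>v (H *\<^sub>v x)" using assms by simp
    moreover have "H *\<^sub>v x \<in> carrier_vec p" using assms x by simp
    ultimately show "y \<in> ?S"
      using col_space_eq[OF assms(1)] assms(1) unfolding col_space_def by auto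
  qed
  then have "VectorSpace.subspace class_ring ?R (vs ?S)"
    using nested_subspaces[OF span_is_subspace[OF cG] span_is_subspace[OF cGH]] by simp
  moreover have "vectorspace class_ring (vs ?S)"
    using span_is_subspace[OF cG] subspace_is_vs by simp
  moreover have "vectorspace.fin_dim class_ring (vs ?S)" and "vectorspace.fin_dim class_ring (vs ?R)"
    using fin_dim_span_cols[OF assms(1)] fin_dim_span_cols[OF GH] by auto
  ultimately have "vectorspace.dim class_ring (vs ?R) \<le> vectorspace.dim class_ring (vs ?S)"
    using vectorspace.subspace_dim[of class_ring "vs ?S" ?R] by simp
  then have "rank (G * H) \<le> rank G" by (simp add: rank_def)
  then show ?thesis using assms by (simp add: mat_rank_def)
qed

lemma mat_rank_le_dim_col: "G \<in> carrier_mat n p \<Longrightarrow> mat_rank G \<le> p"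
  using vec_space.rank_le_nc[of G n p] by (simp add: mat_rank_def)

text \<open>
A trivial kernel makes the columns distinct as well as independent. Distinctness matters because
the rank is defined through the set of columns, which would silently merge repeated ones.
\<close>

lemma mat_rank_eq_dim_col:
  assumes G: "G \<in> carrier_mat n p"
    and ker: "\<And>v. v \<in> carrier_vec p \<Longrightarrow> G *\<^sub>v v = 0\<^sub>v n \<Longrightarrow> v = 0\<^sub>v p"
  shows "mat_rank G = p"
proof -
  interpret vec_space "TYPE(real)" n .
  have unit: "G *\<^sub>v unit_vec p i = col G i" if "i < p" for i
    using that G by (intro eq_vecI) auto
  have dist: "distinct (cols G)"
  proof -
    have False if ij: "i < p" "j < p" "i \<noteq> j" "col G i = col G j" for i j
    proof -
      let ?v = "unit_vec p i - unit_vec p j :: real vec"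
      have "G *\<^sub>v ?v = G *\<^sub>v unit_vec p i - G *\<^sub>v unit_vec p j"
        using G by (simp add: mult_minus_distrib_mat_vec[of _ n p])
      then have "G *\<^sub>v ?v = 0\<^sub>v n"
        using ij unit[of i] unit[of j] G by simp
      then have "?v = 0\<^sub>v p" by (intro ker) auto
      then have "?v $ i = 0\<^sub>v p $ i" by simp
      then show False using ij by simp
    qed
    then show ?thesis using G by (auto simp: distinct_conv_nth)
  qed
  have "lin_indpt (set (cols G))"
    using lin_depE[OF G _ dist] ker by blast
  then show ?thesis
    using lin_indpt_full_rank[OF G dist] G by (simp add: mat_rank_def)
qed

lemma mat_rank_le_dim_row: "G \<in> carrier_mat n p \<Longrightarrow> mat_rank G \<le> n"
proof -
  assume G: "G \<in> carrier_mat n p"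
  interpret vec_space "TYPE(real)" n .
  have "mat_rank (1\<^sub>m n * G) \<le> mat_rank (1\<^sub>m n)"
    using G by (intro mat_rank_mult_le[of _ n n]) auto
  also have "\<dots> \<le> n" by (rule mat_rank_le_dim_col[of _ n]) simp
  finally show ?thesis using G by simp
qed

lemma stiefel_kernel:
  assumes "Y \<in> stiefel n p" and "v \<in> carrier_vec p" and "Y *\<^sub>v v = 0\<^sub>v n"
  shows "v = 0\<^sub>v p"
proof -
  note Y = stiefelD[OF assms(1)]
  have "v = Y\<^sup>T * Y *\<^sub>v v" using Y assms(2) by simp
  also have "\<dots> = Y\<^sup>T *\<^sub>v (Y *\<^sub>v v)" using Y(1) assms(2) by (intro assoc_mult_mat_vec) auto
  also have "\<dots> = 0\<^sub>v p" using Y(1) assms(3) by auto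
  finally show ?thesis .
qed

text \<open>
The factorizations \<open>M = Y * G\<close> and \<open>Y = M * H\<close> bound the rank of \<open>M\<close> from above and from below by that of \<open>Y\<close>.
\<close>

lemma mat_rank_eqI:
  assumes "Y \<in> stiefel n p" and "G \<in> carrier_mat p q" and "H \<in> carrier_mat q p"
    and "M = Y * G" and "M * H = Y"
  shows "mat_rank M = p"
proof (rule antisym)
  note Y = stiefelD[OF assms(1)]
  have M: "M \<in> carrier_mat n q" using assms Y by simp
  show "mat_rank M \<le> p"
    using mat_rank_mult_le[OF Y(1) assms(2)] mat_rank_le_dim_col[OF Y(1)] assms(4) by simp
  have "mat_rank Y = p"
    using mat_rank_eq_dim_col[OF Y(1)] stiefel_kernel[OF assms(1)] by simp
  then show "p \<le> mat_rank M" using mat_rank_mult_le[OF M assms(3)] assms(5) by simp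
qed

lemma mat_rank_stiefel_mult_transpose:
  assumes "Y \<in> stiefel n p" and "Z \<in> stiefel k p"
  shows "mat_rank (Y * Z\<^sup>T) = p"
proof (rule mat_rank_eqI)
  show "Y * Z\<^sup>T * Z = Y"
    using stiefelD[OF assms(1)] stiefelD[OF assms(2)] by simp
qed (use assms stiefelD[OF assms(2)] in auto)

text \<open>
Independent columns of \<open>B\<close> remain independent when the columns of \<open>X\<close>, which are orthonormal and
orthogonal to them, are added; but there are at most \<open>n\<close> independent vectors in all.
\<close>

lemma mat_rank_le_if_orthogonal:
  assumes X: "X \<in> stiefel n k" and B: "B \<in> carrier_mat n q" and XB: "X\<^sup>T * B = 0\<^sub>m k q"
  shows "mat_rank B \<le> n - k"
proof -
  interpret vec_space "TYPE(real)" n .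
  note Xc = stiefelD[OF X]
  obtain S where S: "maximal S (\<lambda>T. T \<subseteq> set (cols B) \<and> lin_indpt T)"
    using maximal_exists_superset[of "set (cols B)" "\<lambda>T. T \<subseteq> set (cols B) \<and> lin_indpt T" "{}"]
    by (auto simp: lin_dep_def)
  have SB: "S \<subseteq> set (cols B)" and Sind: "lin_indpt S" using S by (auto simp: maximal_def)
  obtain ss where ss: "set ss = S" "distinct ss"
    using finite_distinct_list[of S] SB finite_subset by blast
  define C where "C = mat_of_cols n ss"
  have SV: "S \<subseteq> carrier_vec n" using SB cols_dim[of B] B by auto
  have C: "C \<in> carrier_mat n (length ss)" and cC: "cols C = ss"
    using SV ss by (auto simp: C_def)
  have XS: "X\<^sup>T *\<^sub>v s = 0\<^sub>v k" if s: "s \<in> S" for s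
  proof -
    obtain j where j: "j < q" "s = col B j" using subsetD[OF SB s] B
      by (auto simp: in_set_conv_nth)
    have "X\<^sup>T *\<^sub>v s = col (X\<^sup>T * B) j"
      unfolding j(2) by (rule col_mult2[symmetric, of _ k n _ q]) (use j B Xc in auto)
    then show ?thesis using XB j by simp
  qed
  \<comment> \<open>\<open>N\<close> is \<open>X\<close> and \<open>C\<close> side by side; the lower blocks have no rows\<close>
  define N where "N = four_block_mat X C (0\<^sub>m 0 k) (0\<^sub>m 0 (length ss))"
  have N: "N \<in> carrier_mat n (k + length ss)"
    using Xc(1) C four_block_carrier_mat[of X n k "0\<^sub>m 0 (length ss)" 0 "length ss"]
    unfolding N_def by simp
  have XC: "X\<^sup>T *\<^sub>v (C *\<^sub>v w) = 0\<^sub>v k" if w: "w \<in> carrier_vec (length ss)" for w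
  proof -
    have "X\<^sup>T * C = 0\<^sub>m k (length ss)"
    proof (rule eq_matI)
      fix i j assume ij: "i < dim_row (0\<^sub>m k (length ss) :: real mat)"
        "j < dim_col (0\<^sub>m k (length ss) :: real mat)"
      then have "col C j \<in> S" using cols_nth[of j C] cC ss C nth_mem[of j ss] by simp
      then have "(X\<^sup>T *\<^sub>v col C j) $ i = 0" using XS ij by simp
      then show "(X\<^sup>T * C) $$ (i, j) = 0\<^sub>m k (length ss) $$ (i, j)"
        using ij Xc(1) C by simp
    qed (use Xc(1) C in auto)
    then have "X\<^sup>T * C *\<^sub>v w = 0\<^sub>v k" using w by auto
    then show ?thesis using Xc(1) C w by simp
  qed
  have "mat_rank N = k + length ss"
  proof (rule mat_rank_eq_dim_col[OF N])
    fix v assume v: "v \<in> carrier_vec (k + length ss)" and Nv: "N *\<^sub>v v = 0\<^sub>v n"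
    define x w where "x = vec_first v k" and "w = vec_last v (length ss)"
    have xw: "x \<in> carrier_vec k" "w \<in> carrier_vec (length ss)" "v = x @\<^sub>v w"
      using v by (auto simp: x_def w_def)
    have "N *\<^sub>v v = (X *\<^sub>v x + C *\<^sub>v w) @\<^sub>v (0\<^sub>m 0 k *\<^sub>v x + 0\<^sub>m 0 (length ss) *\<^sub>v w)"
      unfolding N_def xw(3) using Xc(1) C xw by (intro four_block_mat_mult_vec) auto
    also have "\<dots> = X *\<^sub>v x + C *\<^sub>v w" using Xc(1) C by (intro eq_vecI) auto
    finally have sum0: "X *\<^sub>v x + C *\<^sub>v w = 0\<^sub>v n" using Nv by simp
    \<comment> \<open>multiplying by \<open>X\<^sup>T\<close> removes the second summand and isolates \<open>x\<close>\<close>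
    have "X\<^sup>T *\<^sub>v (X *\<^sub>v x + C *\<^sub>v w) = X\<^sup>T *\<^sub>v (X *\<^sub>v x) + X\<^sup>T *\<^sub>v (C *\<^sub>v w)"
      using Xc(1) C xw by (intro mult_add_distrib_mat_vec) auto
    also have "X\<^sup>T *\<^sub>v (X *\<^sub>v x) = X\<^sup>T * X *\<^sub>v x"
      using Xc(1) xw by (intro assoc_mult_mat_vec[symmetric]) auto
    finally have "x = 0\<^sub>v k" using XC[OF xw(2)] Xc xw sum0 by auto
    moreover have "X *\<^sub>v 0\<^sub>v k = 0\<^sub>v n" using Xc(1) by auto
    ultimately have "C *\<^sub>v w = 0\<^sub>v n" using sum0 mult_mat_vec_carrier[OF C xw(2)] by simp
    then have "w = 0\<^sub>v (length ss)"
      using lin_depI[OF C xw(2)] cC ss Sind by auto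
    with \<open>x = 0\<^sub>v k\<close> show "v = 0\<^sub>v (k + length ss)" using xw(3) by auto
  qed
  then have "k + length ss \<le> n" using mat_rank_le_dim_row[OF N] by simp
  moreover have "mat_rank B = length ss"
    using rank_card_indpt[OF B S] ss distinct_card[of ss] B by (simp add: mat_rank_def)
  ultimately show ?thesis by simp
qed

section \<open>Positivity of the denominator\<close>

text \<open>
With \<open>y = B x\<close>, the form at \<open>x + t y\<close> is \<open>2 t (y \<bullet> y) + t\<^sup>2 (y \<bullet> B y)\<close>. It would be negative for small
negative \<open>t\<close> unless \<open>y = 0\<close>.
\<close>

lemma psd_quadratic_form_0_imp_kernel:
  assumes B: "B \<in> carrier_mat n n" "psd_mat B" and x: "x \<in> carrier_vec n"
    and x0: "x \<bullet> (B *\<^sub>v x) = 0"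
  shows "B *\<^sub>v x = 0\<^sub>v n"
proof -
  define y where "y = B *\<^sub>v x"
  have y: "y \<in> carrier_vec n" using B x by (simp add: y_def)
  have sym: "B\<^sup>T = B" using B(2) by (simp add: psd_mat_def symmetric_mat_def)
  have nonneg: "0 \<le> v \<bullet> (B *\<^sub>v v)" if "v \<in> carrier_vec n" for v
    using B that by (simp add: psd_mat_def)
  have swap: "x \<bullet> (B *\<^sub>v y) = y \<bullet> y"
    using transpose_vec_mult_scalar[OF B(1) y x] sym y_def
    by (metis B(1) comm_scalar_prod mult_mat_vec_carrier x y)
  define c d where "c = y \<bullet> (B *\<^sub>v y)" and "d = y \<bullet> y"
  have c: "0 \<le> c" using nonneg[OF y] by (simp add: c_def)
  have quad: "0 \<le> 2 * t * d + t\<^sup>2 * c" for t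
  proof -
    have "0 \<le> (x + t \<cdot>\<^sub>v y) \<bullet> (B *\<^sub>v (x + t \<cdot>\<^sub>v y))"
      using x y by (intro nonneg) auto
    also have "B *\<^sub>v (x + t \<cdot>\<^sub>v y) = y + t \<cdot>\<^sub>v (B *\<^sub>v y)"
      using B x y by (simp add: mult_add_distrib_mat_vec[of _ n n] mult_mat_vec[of _ n n] y_def)
    also have "(x + t \<cdot>\<^sub>v y) \<bullet> (y + t \<cdot>\<^sub>v (B *\<^sub>v y)) =
        x \<bullet> y + t * (x \<bullet> (B *\<^sub>v y)) + t * (y \<bullet> y) + t * (t * (y \<bullet> (B *\<^sub>v y)))"
      using B x y by (simp add: add_scalar_prod_distrib[of _ n] scalar_prod_add_distrib[of _ n] algebra_simps)
    also have "x \<bullet> y = 0" using x0 by (simp add: y_def)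
    finally show ?thesis using swap by (simp add: c_def d_def power2_eq_square algebra_simps)
  qed
  have "d = 0"
  proof (rule ccontr)
    assume "d \<noteq> 0"
    \<comment> \<open>\<open>- d / c\<close> would minimize the quadratic polynomial; adding 1 allows for \<open>c = 0\<close>\<close>
    define e t where "e = c + 1" and "t = - d / e"
    have te: "t * e = - d" using c by (simp add: e_def t_def)
    have "0 \<le> e\<^sup>2 * (2 * t * d + t\<^sup>2 * c)" using quad[of t] by simp
    also have "\<dots> = 2 * (t * e) * e * d + (t * e)\<^sup>2 * c"
      by (simp add: power2_eq_square algebra_simps)
    also have "\<dots> = - (d\<^sup>2 * (c + 2))"
      unfolding te by (simp add: e_def power2_eq_square algebra_simps)
    also have "\<dots> < 0" using c \<open>d \<noteq> 0\<close> by simp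
    finally show False by simp
  qed
  then have "y = 0\<^sub>v n" using conjugate_square_eq_0_vec[OF y] by (simp add: d_def)
  then show ?thesis by (simp add: y_def)
qed

lemma mat_trace_quadratic:
  assumes "X \<in> carrier_mat n k" and "B \<in> carrier_mat n n"
  shows "mat_trace (X\<^sup>T * B * X) = (\<Sum>j<k. col X j \<bullet> (B *\<^sub>v col X j))"
proof -
  have "(X\<^sup>T * B * X) $$ (j, j) = col X j \<bullet> (B *\<^sub>v col X j)" if "j < k" for j
  proof -
    have "X\<^sup>T * B * X = X\<^sup>T * (B * X)" using assms by simp
    then have "(X\<^sup>T * B * X) $$ (j, j) = row X\<^sup>T j \<bullet> col (B * X) j"
      using assms that by simp
    also have "col (B * X) j = B *\<^sub>v col X j" by (rule col_mult2[OF assms(2,1) that])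
    finally show ?thesis using assms that by simp
  qed
  then show ?thesis using assms by (simp add: mat_trace_def)
qed

text \<open>
The trace is the sum of the nonnegative values of the form at the columns of \<open>X\<close>. If it were 0,
every column would lie in the kernel of \<open>B\<close>, and by symmetry the columns of \<open>B\<close> would be orthogonal
to the \<open>k\<close> columns of \<open>X\<close>, which leaves \<open>B\<close> a rank of at most \<open>n - k\<close>.
\<close>

lemma mat_trace_quadratic_pos:
  assumes X: "X \<in> stiefel n k" and B: "B \<in> carrier_mat n n" "psd_mat B"
    and rank: "mat_rank B > n - k"
  shows "mat_trace (X\<^sup>T * B * X) > 0"
proof (rule ccontr)
  note Xc = stiefelD(1)[OF X]
  let ?q = "\<lambda>j. col X j \<bullet> (B *\<^sub>v col X j)"
  assume "\<not> mat_trace (X\<^sup>T * B * X) > 0"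
  then have le: "(\<Sum>j<k. ?q j) \<le> 0" using mat_trace_quadratic[OF Xc B(1)] by simp
  have nonneg: "0 \<le> ?q j" if "j < k" for j
    using B Xc that by (simp add: psd_mat_def)
  then have "(\<Sum>j<k. ?q j) = 0" using le by (intro antisym sum_nonneg) auto
  then have "\<forall>j<k. ?q j = 0"
    using sum_nonneg_eq_0_iff[of "{..<k}" ?q] nonneg by auto
  then have ker: "B *\<^sub>v col X j = 0\<^sub>v n" if "j < k" for j
    using psd_quadratic_form_0_imp_kernel[OF B] Xc that by simp
  have "B * X = 0\<^sub>m n k"
  proof (rule eq_matI)
    fix i j assume "i < dim_row (0\<^sub>m n k :: real mat)" "j < dim_col (0\<^sub>m n k :: real mat)"
    then have "(B * X) $$ (i, j) = (B *\<^sub>v col X j) $ i" "i < n" "j < k"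
      using B(1) Xc by simp_all
    then show "(B * X) $$ (i, j) = 0\<^sub>m n k $$ (i, j)" using ker by simp
  qed (use B Xc in auto)
  moreover have "B\<^sup>T = B" using B(2) by (simp add: psd_mat_def symmetric_mat_def)
  ultimately have "X\<^sup>T * B = 0\<^sub>m k n"
    using transpose_mult[OF B(1) Xc] by simp
  then show False using mat_rank_le_if_orthogonal[OF X B(1)] rank by simp
qed

section \<open>Column blocks\<close>

abbreviation id_oplus :: "nat \<Rightarrow> nat \<Rightarrow> real mat \<Rightarrow> real mat" where
  "id_oplus s q W \<equiv> four_block_mat (1\<^sub>m s) (0\<^sub>m s q) (0\<^sub>m q s) W"

lemma cols_range_carrier:
  "M \<in> carrier_mat n k \<Longrightarrow> cols_range M (a + 1) b \<in> carrier_mat n (b - a)"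
  by (intro carrier_matI) (simp_all add: cols_range_def del: upt_Suc)

lemma cols_range_index:
  assumes "M \<in> carrier_mat n k" and "b \<le> k" and "i < n" and "j < b - a"
  shows "cols_range M (a + 1) b $$ (i, j) = M $$ (i, a + j)"
  using assms by (simp add: cols_range_def mat_of_cols_index nth_append del: upt_Suc)

lemma cols_range_stiefel:
  assumes "U \<in> stiefel n k" and "b \<le> k"
  shows "cols_range U (a + 1) b \<in> stiefel n (b - a)"
proof (rule stiefelI)
  note U = stiefelD[OF assms(1)]
  let ?C = "cols_range U (a + 1) b"
  show C: "?C \<in> carrier_mat n (b - a)" by (rule cols_range_carrier[OF U(1)])
  show "?C\<^sup>T * ?C = 1\<^sub>m (b - a)"
  proof (rule eq_matI)
    fix i j assume "i < dim_row (1\<^sub>m (b - a) :: real mat)" "j < dim_col (1\<^sub>m (b - a) :: real mat)"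
    then have ij: "i < b - a" "j < b - a" by auto
    have "(?C\<^sup>T * ?C) $$ (i, j) = (\<Sum>l<n. ?C $$ (l, i) * ?C $$ (l, j))"
      using C ij by (simp add: scalar_prod_def atLeast0LessThan)
    also have "\<dots> = (\<Sum>l<n. U $$ (l, a + i) * U $$ (l, a + j))"
      using cols_range_index[OF U(1) assms(2)] ij by simp
    also have "\<dots> = (if a + i = a + j then 1 else 0)"
      using ij assms(2) by (intro stiefel_sum_col[OF assms(1)]) auto
    finally show "(?C\<^sup>T * ?C) $$ (i, j) = 1\<^sub>m (b - a) $$ (i, j)" using ij by simp
  qed (use C in auto)
qed

lemma id_oplus_stiefel_iff:
  assumes W: "W \<in> carrier_mat q q"
  shows "id_oplus s q W \<in> stiefel (s + q) (s + q) \<longleftrightarrow> W \<in> stiefel q q"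
proof -
  have "(id_oplus s q W)\<^sup>T = id_oplus s q (W\<^sup>T)"
    using W by (subst transpose_four_block_mat[of _ s s _ q _ q]) auto
  moreover have "id_oplus s q (W\<^sup>T) * id_oplus s q W = id_oplus s q (W\<^sup>T * W)"
    using W by (subst mult_four_block_mat[of _ s s _ q _ q _ _ s _ q]) auto
  ultimately have prod: "(id_oplus s q W)\<^sup>T * id_oplus s q W = id_oplus s q (W\<^sup>T * W)" by simp
  have car: "id_oplus s q W \<in> carrier_mat (s + q) (s + q)" using W by auto
  have "W\<^sup>T * W = 1\<^sub>m q" if eq: "id_oplus s q (W\<^sup>T * W) = 1\<^sub>m (s + q)"
  proof (rule eq_matI)
    fix i j assume ij: "i < dim_row (1\<^sub>m q :: real mat)" "j < dim_col (1\<^sub>m q :: real mat)"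
    have "id_oplus s q (W\<^sup>T * W) $$ (s + i, s + j) = 1\<^sub>m (s + q) $$ (s + i, s + j)"
      using eq by simp
    then show "(W\<^sup>T * W) $$ (i, j) = 1\<^sub>m q $$ (i, j)" using ij W by simp
  qed (use W in auto)
  then show ?thesis
    using W car prod by (auto simp: stiefel_def)
qed

text \<open>
Both \<open>U\<close> and \<open>V\<close> are split after column \<open>s\<close>. To stay within two-by-two block matrices, the splitting
carries a lower block row of height 0, which disappears again in the product.
\<close>

lemma mult_id_oplus_mult_transpose:
  assumes U: "U \<in> carrier_mat n k" and V: "V \<in> carrier_mat l k"
    and s: "s \<le> k" and W: "W \<in> carrier_mat (k - s) (k - s)"
  shows "U * id_oplus s (k - s) W * V\<^sup>T =
    cols_range U 1 s * (cols_range V 1 s)\<^sup>T +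
    cols_range U (s + 1) k * W * (cols_range V (s + 1) k)\<^sup>T"
proof -
  let ?split = "\<lambda>M m. four_block_mat (cols_range M 1 s) (cols_range M (s + 1) k) (0\<^sub>m 0 s) (0\<^sub>m 0 (k - s))"
  have car: "cols_range M 1 s \<in> carrier_mat m s" "cols_range M (s + 1) k \<in> carrier_mat m (k - s)"
    if "M \<in> carrier_mat m k" for M m
    using cols_range_carrier[OF that, of 0 s] cols_range_carrier[OF that, of s k] by auto
  have split: "M = ?split M m" if M: "M \<in> carrier_mat m k" for M m
  proof (rule eq_matI)
    fix i j assume "i < dim_row (?split M m)" "j < dim_col (?split M m)"
    then have "i < m" "j < k" using car[OF M] s by auto
    then show "M $$ (i, j) = ?split M m $$ (i, j)"
      using car[OF M] s cols_range_index[OF M s, of i j 0] cols_range_index[OF M order_refl, of i "j - s" s]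
      by auto
  qed (use M car[OF M] s in auto)
  let ?U1 = "cols_range U 1 s" and ?U2 = "cols_range U (s + 1) k"
  let ?V1 = "cols_range V 1 s" and ?V2 = "cols_range V (s + 1) k"
  note cU = car[OF U] and cV = car[OF V]
  have UW: "?split U n * id_oplus s (k - s) W = four_block_mat ?U1 (?U2 * W) (0\<^sub>m 0 s) (0\<^sub>m 0 (k - s))"
    using cU W by (subst mult_four_block_mat[of _ n s _ "k - s" _ 0 _ _ s _ "k - s"]) auto
  have VT: "(?split V l)\<^sup>T = four_block_mat ?V1\<^sup>T (0\<^sub>m s 0) ?V2\<^sup>T (0\<^sub>m (k - s) 0)"
    using cV by (subst transpose_four_block_mat[of _ l s _ "k - s" _ 0]) auto
  have "four_block_mat ?U1 (?U2 * W) (0\<^sub>m 0 s) (0\<^sub>m 0 (k - s)) *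
        four_block_mat ?V1\<^sup>T (0\<^sub>m s 0) ?V2\<^sup>T (0\<^sub>m (k - s) 0) =
      four_block_mat (?U1 * ?V1\<^sup>T + ?U2 * W * ?V2\<^sup>T) (0\<^sub>m n 0) (0\<^sub>m 0 l) (0\<^sub>m 0 0)"
    using cU cV W
    by (subst mult_four_block_mat[of _ n s _ "k - s" _ 0 _ _ l _ 0]) (auto intro!: cong_four_block_mat)
  also have "\<dots> = ?U1 * ?V1\<^sup>T + ?U2 * W * ?V2\<^sup>T"
    using cU cV W by (intro eq_matI) auto
  finally have "?split U n * id_oplus s (k - s) W * (?split V l)\<^sup>T = ?U1 * ?V1\<^sup>T + ?U2 * W * ?V2\<^sup>T"
    unfolding UW VT .
  then show ?thesis unfolding split[OF U, symmetric] split[OF V, symmetric] .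
qed

section \<open>Diagonal matrices and singular value decompositions\<close>

definition diagonal :: "nat \<Rightarrow> (nat \<Rightarrow> real) \<Rightarrow> real mat" where
  "diagonal k d = mat k k (\<lambda>(i, j). if i = j then d i else 0)"

lemma diagonal_carrier [simp]: "diagonal k d \<in> carrier_mat k k"
  and diagonal_dim [simp]: "dim_row (diagonal k d) = k" "dim_col (diagonal k d) = k"
  by (simp_all add: diagonal_def)

lemma diagonal_mult:
  assumes "Z \<in> carrier_mat k q"
  shows "diagonal k d * Z = mat k q (\<lambda>(i, j). d i * Z $$ (i, j))"
proof (rule eq_matI)
  fix i j assume "i < dim_row (mat k q (\<lambda>(i, j). d i * Z $$ (i, j)))"
    "j < dim_col (mat k q (\<lambda>(i, j). d i * Z $$ (i, j)))"
  then have ij: "i < k" "j < q" by auto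
  then have "(diagonal k d * Z) $$ (i, j) = (\<Sum>l<k. (if i = l then d i else 0) * Z $$ (l, j))"
    using assms by (simp add: diagonal_def scalar_prod_def atLeast0LessThan)
  also have "\<dots> = (\<Sum>l<k. if i = l then d i * Z $$ (l, j) else 0)"
    by (intro sum.cong) auto
  also have "\<dots> = d i * Z $$ (i, j)" using ij by simp
  finally show "(diagonal k d * Z) $$ (i, j) = mat k q (\<lambda>(i, j). d i * Z $$ (i, j)) $$ (i, j)"
    using ij by simp
qed (use assms in auto)

lemma mat_trace_mult_diagonal:
  assumes "P \<in> carrier_mat k k"
  shows "mat_trace (P\<^sup>T * diagonal k d) = (\<Sum>i<k. d i * P $$ (i, i))"
proof -
  have "mat_trace (P\<^sup>T * diagonal k d) = mat_trace (diagonal k d * P\<^sup>T)"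
    using assms by (intro mat_trace_comm[of _ k k]) auto
  then show ?thesis
    using assms by (simp add: diagonal_mult[of "P\<^sup>T" k k] mat_trace_def)
qed

lemma four_block_diagonal:
  "four_block_mat (diagonal p d) (0\<^sub>m p q) (0\<^sub>m q p) (c \<cdot>\<^sub>m 1\<^sub>m q) =
    diagonal (p + q) (\<lambda>i. if i < p then d i else c)"
  by (rule eq_matI) (auto simp: diagonal_def)

text \<open>
The bound by \<open>\<mu> t\<close> from below is what keeps the sequence nonincreasing when the next block is
appended; with \<open>\<mu> t \<ge> 0\<close> it also makes all entries nonnegative.
\<close>

lemma block_diag_eq_diagonal:
  assumes "\<And>i. 1 \<le> i \<Longrightarrow> i < t \<Longrightarrow> \<mu> i \<ge> \<mu> (i + 1)"
  shows "\<exists>d. block_diag t \<mu> m = diagonal (\<Sum>i=1..t. m i) d \<and>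
    (\<forall>j<\<Sum>i=1..t. m i. \<mu> t \<le> d j \<and> (\<forall>i\<le>j. d j \<le> d i))"
  using assms
proof (induction t)
  case 0
  have "block_diag 0 \<mu> m = diagonal 0 (\<lambda>_. 0)"
    by (rule eq_matI) (auto simp: block_diag_def)
  then show ?case by auto
next
  case (Suc t)
  let ?K = "\<Sum>i=1..t. m i"
  obtain d where d: "block_diag t \<mu> m = diagonal ?K d"
    and mono: "\<And>i j. j < ?K \<Longrightarrow> \<mu> t \<le> d j \<and> (\<forall>i\<le>j. d j \<le> d i)"
    using Suc.IH Suc.prems by auto
  let ?d = "\<lambda>i. if i < ?K then d i else \<mu> (Suc t)"
  have "block_diag (Suc t) \<mu> m =
      four_block_mat (block_diag t \<mu> m) (0\<^sub>m ?K (m (Suc t))) (0\<^sub>m (m (Suc t)) ?K) (\<mu> (Suc t) \<cdot>\<^sub>m 1\<^sub>m (m (Suc t)))"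
    using diag_block_mat_last[of "map (\<lambda>i. \<mu> i \<cdot>\<^sub>m 1\<^sub>m (m i)) [1..<Suc t]" "\<mu> (Suc t) \<cdot>\<^sub>m 1\<^sub>m (m (Suc t))"] d
    by (simp add: block_diag_def Let_def)
  then have eq: "block_diag (Suc t) \<mu> m = diagonal (\<Sum>i=1..Suc t. m i) ?d"
    unfolding d by (simp add: four_block_diagonal)
  have "\<mu> (Suc t) \<le> ?d j \<and> (\<forall>i\<le>j. ?d j \<le> ?d i)" if "j < (\<Sum>i=1..Suc t. m i)" for j
  proof -
    have last: "\<mu> (Suc t) \<le> d i" if "i < ?K" for i
    proof -
      have "t \<ge> 1" using that by (cases t) auto
      then show ?thesis using Suc.prems[of t] mono[OF that] by auto
    qed
    then show ?thesis using mono by auto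
  qed
  with eq show ?case by blast
qed

lemma transpose_mult_mult:
  fixes G :: "real mat"
  assumes "G \<in> carrier_mat n k" and "Z \<in> carrier_mat k l" and "H \<in> carrier_mat l q"
  shows "(G * Z * H)\<^sup>T = H\<^sup>T * (Z\<^sup>T * G\<^sup>T)"
proof -
  have "(G * Z * H)\<^sup>T = H\<^sup>T * (G * Z)\<^sup>T"
    using assms by (intro transpose_mult) auto
  then show ?thesis by (simp only: transpose_mult[OF assms(1,2)])
qed

lemma svd_conj:
  assumes U: "U \<in> stiefel n k" and V: "V \<in> carrier_mat l k" and Z: "Z \<in> carrier_mat k k"
  shows "(U * Z * V\<^sup>T)\<^sup>T * (U * Z * V\<^sup>T) = V * (Z\<^sup>T * Z) * V\<^sup>T"
proof -
  note Uc = stiefelD(1)[OF U]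
  have "(U * Z * V\<^sup>T)\<^sup>T = V * (Z\<^sup>T * U\<^sup>T)"
    using transpose_mult_mult[OF Uc Z, of "V\<^sup>T" l] V by simp
  then have "(U * Z * V\<^sup>T)\<^sup>T * (U * Z * V\<^sup>T) = V * (Z\<^sup>T * (U\<^sup>T * (U * (Z * V\<^sup>T))))"
    using Uc V Z by (simp add: assoc_mult_mat[of _ l k _ n _ l] assoc_mult_mat[of _ k k _ n _ l]
        assoc_mult_mat[of _ n k _ k _ l] assoc_mult_mat[of _ k n _ k _ l])
  also have "U\<^sup>T * (U * (Z * V\<^sup>T)) = Z * V\<^sup>T"
    using Z V by (intro stiefel_cancel[OF U, of _ l]) auto
  finally show ?thesis
    using V Z by (simp add: assoc_mult_mat[of _ l k _ k _ l] assoc_mult_mat[of _ k k _ k _ l])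
qed

lemma proots_prod_linear:
  "proots (\<Prod>a\<leftarrow>xs. [:- a, 1:]) = mset (xs :: real list)"
proof -
  have "proots (\<Prod>a\<leftarrow>xs. [:- a, 1:]) = (\<Sum>p\<leftarrow>map (\<lambda>a. [:- a, 1:]) xs. proots p)"
    using proots_prod_list[of "map (\<lambda>a. [:- a, 1:]) xs"] by (simp add: image_iff)
  also have "\<dots> = mset xs" by (induction xs) auto
  finally show ?thesis .
qed

text \<open>
The Gram matrix of \<open>U D V\<^sup>T\<close> is \<open>V D\<^sup>2 V\<^sup>T\<close>, similar to \<open>D\<^sup>2\<close>, so the squares of the diagonal entries are
the roots of its characteristic polynomial.
\<close>

lemma trace_norm_svd:
  assumes U: "U \<in> stiefel k k" and V: "V \<in> stiefel k k" and d: "\<And>i. i < k \<Longrightarrow> 0 \<le> d i"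
  shows "trace_norm (U * diagonal k d * V\<^sup>T) = (\<Sum>i<k. d i)"
proof -
  note Uc = stiefelD[OF U] and Vc = stiefelD[OF V]
  let ?M = "U * diagonal k d * V\<^sup>T" and ?D = "diagonal k (\<lambda>i. (d i)\<^sup>2)"
  have "(diagonal k d)\<^sup>T * diagonal k d = diagonal k d * diagonal k d"
    by (intro arg_cong2[where f = "(*)"] eq_matI) (auto simp: diagonal_def)
  also have "\<dots> = ?D"
    by (subst diagonal_mult[of _ k k]) (auto simp: diagonal_def power2_eq_square intro!: eq_matI)
  finally have "?M\<^sup>T * ?M = V * ?D * V\<^sup>T"
    using svd_conj[OF U Vc(1), of "diagonal k d"] by simp
  then have "similar_mat (?M\<^sup>T * ?M) ?D"
    using Uc Vc stiefel_square_right_inverse[OF V] by (intro similar_matI[of _ _ V "V\<^sup>T" k]) auto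
  then have "char_poly (?M\<^sup>T * ?M) = char_poly ?D" by (rule char_poly_similar)
  also have "\<dots> = (\<Prod>a\<leftarrow>diag_mat ?D. [:- a, 1:])"
    by (rule char_poly_upper_triangular[of _ k]) (auto simp: diagonal_def)
  also have "diag_mat ?D = map (\<lambda>i. (d i)\<^sup>2) [0..<k]"
    by (auto simp: diag_mat_def diagonal_def)
  finally have "singular_values ?M = image_mset sqrt (mset (map (\<lambda>i. (d i)\<^sup>2) [0..<k]))"
    by (simp only: singular_values_def proots_prod_linear)
  then have "trace_norm ?M = (\<Sum>i\<leftarrow>[0..<k]. sqrt ((d i)\<^sup>2))"
    by (simp add: trace_norm_def sum_mset_sum_list[symmetric] image_mset.compositionality comp_def flip: mset_map)
  also have "\<dots> = (\<Sum>i<k. sqrt ((d i)\<^sup>2))"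
    by (simp add: interv_sum_list_conv_sum_set_nat atLeast0LessThan)
  finally show ?thesis using d by simp
qed

text \<open>
The matrix is \<open>U\<^sub>1 D\<^sub>1 V\<^sub>1\<^sup>T\<close>, where the index 1 marks the part that belongs to the nonzero
diagonal entries, and multiplying it by \<open>V\<^sub>1 D\<^sub>1\<^sup>-\<^sup>1\<close> recovers \<open>U\<^sub>1\<close>.
\<close>

lemma mat_rank_svd:
  assumes U: "U \<in> stiefel k k" and V: "V \<in> stiefel k k" and s: "s \<le> k"
    and d: "\<And>i. i < k \<Longrightarrow> d i \<noteq> 0 \<longleftrightarrow> i < s"
  shows "mat_rank (U * diagonal k d * V\<^sup>T) = s"
proof (rule mat_rank_eqI)
  note Uc = stiefelD[OF U] and Vc = stiefelD[OF V]
  have d0: "d i = 0" if "s \<le> i" "i < k" for i using d[of i] that by auto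
  have dn: "d i \<noteq> 0" if "i < s" for i using d[of i] that s by auto
  let ?Y = "cols_range U 1 s"
  let ?G = "mat s k (\<lambda>(i, j). d i * V $$ (j, i))"
  let ?H = "mat k s (\<lambda>(j, i). V $$ (j, i) / d i)"
  let ?E = "mat k s (\<lambda>(i, j). if i = j then 1 else 0 :: real)"
  show "?Y \<in> stiefel k s" using cols_range_stiefel[OF U s, of 0] by simp
  have Yc: "?Y \<in> carrier_mat k s" using cols_range_carrier[OF Uc(1), of 0 s] by simp
  have Y: "?Y $$ (i, j) = U $$ (i, j)" if "i < k" "j < s" for i j
    using cols_range_index[OF Uc(1) s, of i j 0] that by simp
  have DV: "diagonal k d * V\<^sup>T = mat k k (\<lambda>(i, j). d i * V $$ (j, i))"
    using Vc by (subst diagonal_mult[of _ k k]) (auto intro!: eq_matI)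
  have UDV: "U * diagonal k d * V\<^sup>T = U * (diagonal k d * V\<^sup>T)"
    using Uc Vc by (intro assoc_mult_mat) auto
  show "U * diagonal k d * V\<^sup>T = ?Y * ?G"
    unfolding UDV DV
  proof (rule eq_matI)
    fix i j assume "i < dim_row (?Y * ?G)" "j < dim_col (?Y * ?G)"
    then have ij: "i < k" "j < k" using Yc by auto
    then have "(U * mat k k (\<lambda>(i, j). d i * V $$ (j, i))) $$ (i, j) = (\<Sum>l<k. U $$ (i, l) * (d l * V $$ (j, l)))"
      using Uc by (simp add: scalar_prod_def atLeast0LessThan)
    also have "\<dots> = (\<Sum>l<s. U $$ (i, l) * (d l * V $$ (j, l)))"
      using s d0 by (intro sum.mono_neutral_right) auto
    also have "\<dots> = (?Y * ?G) $$ (i, j)"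
      using ij Yc Y by (simp add: scalar_prod_def atLeast0LessThan)
    finally show "(U * mat k k (\<lambda>(i, j). d i * V $$ (j, i))) $$ (i, j) = (?Y * ?G) $$ (i, j)" .
  qed (use Uc Yc in auto)
  have VH: "V\<^sup>T * ?H = mat k s (\<lambda>(i, j). if i = j then 1 / d j else 0)"
  proof (rule eq_matI)
    fix i j assume "i < dim_row (mat k s (\<lambda>(i, j). if i = j then 1 / d j else 0))"
      "j < dim_col (mat k s (\<lambda>(i, j). if i = j then 1 / d j else 0))"
    then have ij: "i < k" "j < s" by auto
    then have "(V\<^sup>T * ?H) $$ (i, j) = (\<Sum>l<k. V $$ (l, i) * V $$ (l, j)) / d j"
      using Vc by (simp add: scalar_prod_def atLeast0LessThan sum_divide_distrib)
    then show "(V\<^sup>T * ?H) $$ (i, j) = mat k s (\<lambda>(i, j). if i = j then 1 / d j else 0) $$ (i, j)"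
      using stiefel_sum_col[OF V, of i j] ij s by simp
  qed (use Vc in auto)
  have DVH: "diagonal k d * (V\<^sup>T * ?H) = ?E"
    unfolding VH using dn s by (subst diagonal_mult[of _ k s]) (auto intro!: eq_matI)
  have "U * diagonal k d * V\<^sup>T * ?H = U * (diagonal k d * V\<^sup>T * ?H)"
    unfolding UDV using Uc Vc by (intro assoc_mult_mat[of _ k k _ k _ s] mult_carrier_mat[of _ k k]) auto
  also have "diagonal k d * V\<^sup>T * ?H = diagonal k d * (V\<^sup>T * ?H)"
    using Vc by (intro assoc_mult_mat[of _ k k _ k _ s]) auto
  also have "U * (diagonal k d * (V\<^sup>T * ?H)) = ?Y"
    unfolding DVH
  proof (rule eq_matI)
    fix i j assume "i < dim_row ?Y" "j < dim_col ?Y"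
    then have ij: "i < k" "j < s" using Yc by auto
    then have "(U * ?E) $$ (i, j) = (\<Sum>l<k. U $$ (i, l) * (if l = j then 1 else 0))"
      using Uc by (simp add: scalar_prod_def atLeast0LessThan)
    also have "\<dots> = U $$ (i, j)" using ij s by (simp add: if_distrib cong: if_cong)
    finally show "(U * ?E) $$ (i, j) = ?Y $$ (i, j)" using Y ij by simp
  qed (use Uc Yc in auto)
  finally show "U * diagonal k d * V\<^sup>T * ?H = ?Y" .
qed auto

lemma psd_mat_conj_diagonal:
  assumes V: "V \<in> carrier_mat k k" and d: "\<And>i. i < k \<Longrightarrow> 0 \<le> d i"
  shows "psd_mat (V * diagonal k d * V\<^sup>T)"
  unfolding psd_mat_def symmetric_mat_def
proof (intro conjI ballI)
  let ?D = "diagonal k d"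
  have DT: "?D\<^sup>T = ?D" by (rule eq_matI) (auto simp: diagonal_def)
  show "(V * ?D * V\<^sup>T)\<^sup>T = V * ?D * V\<^sup>T"
  proof -
    have "(V * ?D * V\<^sup>T)\<^sup>T = V * (?D * V\<^sup>T)"
      using transpose_mult_mult[OF V diagonal_carrier, of "V\<^sup>T" k d] V DT by simp
    then show ?thesis using V assoc_mult_mat[OF V diagonal_carrier, of "V\<^sup>T" k d] by simp
  qed
  fix v :: "real vec" assume "v \<in> carrier_vec (dim_row (V * ?D * V\<^sup>T))"
  then have v: "v \<in> carrier_vec k" using V by simp
  define w where "w = V\<^sup>T *\<^sub>v v"
  have w: "w \<in> carrier_vec k" using V v by (simp add: w_def)
  have "v \<bullet> (V * ?D * V\<^sup>T *\<^sub>v v) = v \<bullet> (V *\<^sub>v (?D *\<^sub>v w))"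
    using V v by (simp add: w_def assoc_mult_mat_vec[of _ k k _ k])
  also have "\<dots> = w \<bullet> (?D *\<^sub>v w)"
    using transpose_vec_mult_scalar[OF V mult_mat_vec_carrier[OF diagonal_carrier w] v]
    by (simp add: w_def)
  also have "\<dots> = (\<Sum>i<k. d i * (w $ i)\<^sup>2)"
  proof -
    have "(?D *\<^sub>v w) $ i = d i * w $ i" if "i < k" for i
    proof -
      have "(?D *\<^sub>v w) $ i = (\<Sum>l<k. (if i = l then d i else 0) * w $ l)"
        using that w by (simp add: diagonal_def scalar_prod_def atLeast0LessThan)
      also have "\<dots> = (\<Sum>l<k. if i = l then d i * w $ l else 0)" by (intro sum.cong) auto
      finally show ?thesis using that by simp
    qed
    then show ?thesis
      using w by (simp add: scalar_prod_def atLeast0LessThan power2_eq_square algebra_simps)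
  qed
  also have "0 \<le> \<dots>" using d by (intro sum_nonneg) auto
  finally show "0 \<le> v \<bullet> (V * ?D * V\<^sup>T *\<^sub>v v)" .
qed (use V in auto)

section \<open>The maximal trace over the orthogonal group\<close>

text \<open>
Cyclic invariance of the trace moves \<open>V\<^sup>T\<close> to the front.
\<close>

lemma mat_trace_rotated_svd:
  assumes Q: "Q \<in> stiefel k k" and U: "U \<in> stiefel k k" and V: "V \<in> stiefel k k"
  shows "mat_trace (Q\<^sup>T * (U * diagonal k d * V\<^sup>T)) = (\<Sum>i<k. d i * (U\<^sup>T * Q * V) $$ (i, i))"
proof -
  note c = stiefelD(1)[OF Q] stiefelD(1)[OF U] stiefelD(1)[OF V]
  note assoc = assoc_mult_mat[of _ k k _ k _ k]
  have "mat_trace (Q\<^sup>T * (U * diagonal k d * V\<^sup>T)) = mat_trace (Q\<^sup>T * U * diagonal k d * V\<^sup>T)"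
    using c by (simp add: assoc)
  also have "\<dots> = mat_trace (V\<^sup>T * (Q\<^sup>T * U * diagonal k d))"
    using c by (intro mat_trace_comm) auto
  also have "V\<^sup>T * (Q\<^sup>T * U * diagonal k d) = (U\<^sup>T * Q * V)\<^sup>T * diagonal k d"
    using c by (simp add: transpose_mult[of _ k k _ k] assoc)
  finally show ?thesis using mat_trace_mult_diagonal[of "U\<^sup>T * Q * V" k d] c by simp
qed

lemma sum_diagonal_stiefel_le:
  assumes P: "P \<in> stiefel k k" and d: "\<And>i. i < k \<Longrightarrow> 0 \<le> d i"
  shows "(\<Sum>i<k. d i * P $$ (i, i)) \<le> (\<Sum>i<k. d i)"
  using stiefel_entry_le_1[OF P] d by (intro sum_mono) (simp add: mult_left_le)

text \<open>
Equality forces a diagonal entry 1 wherever \<open>d\<close> is positive. Such an entry clears its column, and,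
as the transpose is orthogonal too, also its row.
\<close>

lemma sum_diagonal_stiefel_eq_imp_id_oplus:
  assumes P: "P \<in> stiefel k k" and d: "\<And>i. i < k \<Longrightarrow> 0 \<le> d i"
    and s: "s \<le> k" and pos: "\<And>i. i < s \<Longrightarrow> 0 < d i"
    and eq: "(\<Sum>i<k. d i * P $$ (i, i)) = (\<Sum>i<k. d i)"
  obtains W where "W \<in> stiefel (k - s) (k - s)" and "P = id_oplus s (k - s) W"
proof -
  note Pc = stiefelD(1)[OF P]
  have diag: "P $$ (i, i) = 1" if i: "i < s" for i
  proof -
    have "(\<Sum>i<k. d i - d i * P $$ (i, i)) = 0" using eq by (simp add: sum_subtractf)
    moreover have "0 \<le> d i - d i * P $$ (i, i)" if "i < k" for i
      using stiefel_entry_le_1[OF P that that] d[OF that] by (simp add: mult_left_le)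
    ultimately have "d i - d i * P $$ (i, i) = 0"
      using sum_nonneg_eq_0_iff[of "{..<k}" "\<lambda>i. d i - d i * P $$ (i, i)"] i s by auto
    then show ?thesis using pos[OF i] by simp
  qed
  have col0: "P $$ (l, i) = 0" if "i < s" "l < k" "l \<noteq> i" for i l
    using stiefel_entry_1_imp_0[OF P, of i i l] that s diag by simp
  have row0: "P $$ (i, l) = 0" if "i < s" "l < k" "l \<noteq> i" for i l
    using stiefel_entry_1_imp_0[OF stiefel_square_transpose[OF P], of i i l] that s diag Pc by simp
  define W where "W = mat (k - s) (k - s) (\<lambda>(i, j). P $$ (s + i, s + j))"
  have eqP: "P = id_oplus s (k - s) W"
  proof (rule eq_matI)
    fix i j assume "i < dim_row (id_oplus s (k - s) W)" "j < dim_col (id_oplus s (k - s) W)"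
    then have "i < k" "j < k" using s by (auto simp: W_def)
    then show "P $$ (i, j) = id_oplus s (k - s) W $$ (i, j)"
      using s diag col0[of j i] row0[of i j] by (auto simp: W_def)
  qed (use Pc s in \<open>auto simp: W_def\<close>)
  have "W \<in> carrier_mat (k - s) (k - s)" by (simp add: W_def)
  then have "W \<in> stiefel (k - s) (k - s)"
    using id_oplus_stiefel_iff[of W "k - s" s] P eqP s by simp
  then show ?thesis using eqP that by blast
qed

lemma f_theta_mult_orthogonal:
  assumes A: "A \<in> carrier_mat n n" and B: "B \<in> carrier_mat n n" and D: "D \<in> carrier_mat n k"
    and X: "X \<in> carrier_mat n k" and Q: "Q \<in> stiefel k k"
  shows "f_theta A B D \<theta> (X * Q) =
    (mat_trace (X\<^sup>T * A * X) + mat_trace (Q\<^sup>T * (X\<^sup>T * D))) / mat_trace (X\<^sup>T * B * X) powr \<theta>"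
proof -
  note Qc = stiefelD(1)[OF Q]
  have T: "(X * Q)\<^sup>T = Q\<^sup>T * X\<^sup>T" by (rule transpose_mult[OF X Qc])
  have conj: "(X * Q)\<^sup>T * G * (X * Q) = Q\<^sup>T * (X\<^sup>T * G * X) * Q" if "G \<in> carrier_mat n n" for G
    unfolding T using X Qc that
    by (simp add: assoc_mult_mat[of _ k n _ n _ n] assoc_mult_mat[of _ k n _ n _ k]
        assoc_mult_mat[of _ n k _ k _ k] assoc_mult_mat[of _ k k _ n _ k] assoc_mult_mat[of _ k k _ n _ n]
        assoc_mult_mat[of _ k k _ k _ k] assoc_mult_mat[of _ n n _ k _ k] assoc_mult_mat[of _ k n _ k _ k])
  have tr: "mat_trace ((X * Q)\<^sup>T * G * (X * Q)) = mat_trace (X\<^sup>T * G * X)" if "G \<in> carrier_mat n n" for G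
    unfolding conj[OF that] using mat_trace_conj[OF Q, of "X\<^sup>T * G * X"] X that by auto
  have "(X * Q)\<^sup>T * D = Q\<^sup>T * (X\<^sup>T * D)"
    unfolding T using X Qc D by (intro assoc_mult_mat) auto
  moreover have "mat_trace ((X * Q)\<^sup>T * A * (X * Q) + (X * Q)\<^sup>T * D) =
      mat_trace ((X * Q)\<^sup>T * A * (X * Q)) + mat_trace ((X * Q)\<^sup>T * D)"
    using X Qc A D by (intro mat_trace_add[of _ k]) auto
  ultimately show ?thesis using tr[OF A] tr[OF B] by (simp add: f_theta_def)
qed

theorem theorem3p2:
  fixes n k r t :: nat
    and A B D X U V \<Sigma> :: "real mat"
    and \<theta> :: real
    and \<mu> :: "nat \<Rightarrow> real"
    and m :: "nat \<Rightarrow> nat"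
  assumes "1 \<le> k" and "k < n"
    and "A \<in> carrier_mat n n" and "symmetric_mat A"
    and "B \<in> carrier_mat n n" and "psd_mat B" and "mat_rank B > n - k"
    and "D \<in> carrier_mat n k"
    and "0 \<le> \<theta>" and "\<theta> \<le> 1"
    and "X \<in> stiefel n k"
    and "U \<in> stiefel k k" and "V \<in> stiefel k k"
    and "\<Sigma> = block_diag t \<mu> m"
    and "\<And>i. 1 \<le> i \<Longrightarrow> i < t \<Longrightarrow> \<mu> i > \<mu> (i + 1)" and "\<mu> t \<ge> 0"
    and "(\<Sum>i=1..t. m i) = k" and "\<And>i. 1 \<le> i \<Longrightarrow> i \<le> t \<Longrightarrow> 1 \<le> m i"
    and "transpose_mat X * D = U * \<Sigma> * transpose_mat V"
    and "r = mat_rank (transpose_mat X * D)"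
  shows
    "let maximizer = is_arg_max (\<lambda>Q. f_theta A B D \<theta> (X * Q)) (\<lambda>Q. Q \<in> stiefel k k);
         S = X * cols_range U 1 r * transpose_mat (cols_range V 1 r);
         T = (\<lambda>W. X * cols_range U (r + 1) k * W * transpose_mat (cols_range V (r + 1) k))
     in (\<forall>Q. maximizer Q \<longrightarrow>
            (\<exists>W \<in> stiefel (k - r) (k - r). X * Q = S + T W)
          \<and> transpose_mat (X * Q) * D = V * \<Sigma> * transpose_mat V
          \<and> psd_mat (transpose_mat (X * Q) * D)
          \<and> mat_trace (transpose_mat (X * Q) * D) = trace_norm (transpose_mat X * D))
      \<and> mat_rank S = r
      \<and> (\<forall>W \<in> stiefel (k - r) (k - r). mat_rank (T W) = k - r)
      \<and> (\<forall>W \<in> stiefel (k - r) (k - r). \<exists>Q. maximizer Q \<and> X * Q = S + T W)"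
proof -
  let ?c = "\<lambda>Q. f_theta A B D \<theta> (X * Q)"
  let ?maximizer = "is_arg_max ?c (\<lambda>Q. Q \<in> stiefel k k)"
  let ?U1 = "cols_range U 1 r" and ?U2 = "cols_range U (r + 1) k"
  let ?V1 = "cols_range V 1 r" and ?V2 = "cols_range V (r + 1) k"
  let ?S = "X * ?U1 * ?V1\<^sup>T" and ?T = "\<lambda>W. X * ?U2 * W * ?V2\<^sup>T"
  note Xs = assms(11) and Us = assms(12) and Vs = assms(13)
  note Xc = stiefelD(1)[OF Xs] and Uc = stiefelD(1)[OF Us] and Vc = stiefelD(1)[OF Vs]
  note assoc = assoc_mult_mat[of _ k k _ k _ k]
  define M where "M = X\<^sup>T * D"
  have t: "1 \<le> t" using assms(1,17) by (cases t) auto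
  obtain d where \<Sigma>: "\<Sigma> = diagonal k d"
    and d_ge: "\<And>j. j < k \<Longrightarrow> 0 \<le> d j" and d_mono: "\<And>i j. j < k \<Longrightarrow> i \<le> j \<Longrightarrow> d j \<le> d i"
  proof -
    have "\<mu> (i + 1) \<le> \<mu> i" if "1 \<le> i" "i < t" for i using assms(15)[OF that] by simp
    then obtain d where "block_diag t \<mu> m = diagonal k d"
      and d: "\<forall>j<k. \<mu> t \<le> d j \<and> (\<forall>i\<le>j. d j \<le> d i)"
      using block_diag_eq_diagonal[of t \<mu> m] unfolding assms(17) by blast
    then show ?thesis using assms(14,16) that[of d] order_trans[OF assms(16)] by blast
  qed
  have \<Sigma>c: "\<Sigma> \<in> carrier_mat k k" unfolding \<Sigma> by simp
  have M: "M = U * \<Sigma> * V\<^sup>T" using assms(19) by (simp add: M_def)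

  \<comment> \<open>As \<open>d\<close> is nonincreasing, its positive values are those before its first zero, and \<open>s\<close> counts them.\<close>
  define s where "s = (LEAST i. i = k \<or> d i = 0)"
  have s_least: "s = k \<or> d s = 0" unfolding s_def by (rule LeastI[of _ k]) simp
  have s_le: "s \<le> k" unfolding s_def by (rule Least_le) simp
  have nz: "d i \<noteq> 0" if "i < s" for i
    using not_less_Least[OF that[unfolded s_def]] by simp
  have z: "d i = 0" if "s \<le> i" "i < k" for i
    using s_least d_mono[of i s] d_ge[of i] that by auto
  have rs: "r = s"
    unfolding assms(20) M_def[symmetric] M \<Sigma>
  proof (rule mat_rank_svd[OF Us Vs s_le])
    show "d i \<noteq> 0 \<longleftrightarrow> i < s" if "i < k" for i
      using nz[of i] z[of i] that by (cases "i < s") auto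
  qed
  have rk: "r \<le> k" and pos: "\<And>i. i < r \<Longrightarrow> 0 < d i" and zero: "\<And>i. r \<le> i \<Longrightarrow> i < k \<Longrightarrow> d i = 0"
    using s_le nz z d_ge by (auto simp: rs less_le)

  have trM: "mat_trace (Q\<^sup>T * M) = (\<Sum>i<k. d i * (U\<^sup>T * Q * V) $$ (i, i))" if "Q \<in> stiefel k k" for Q
    unfolding M \<Sigma> by (rule mat_trace_rotated_svd[OF that Us Vs])
  have rot: "U\<^sup>T * Q * V \<in> stiefel k k" if "Q \<in> stiefel k k" for Q
    using stiefel_mult[OF stiefel_mult[OF stiefel_square_transpose[OF Us] that] Vs] .
  have unrot: "U * (U\<^sup>T * Q * V) * V\<^sup>T = Q" if "Q \<in> stiefel k k" for Q
  proof -
    have Qc: "Q \<in> carrier_mat k k" by (rule stiefelD(1)[OF that])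
    have "U * (U\<^sup>T * Q * V) * V\<^sup>T = (U * U\<^sup>T) * Q * (V * V\<^sup>T)" using Uc Vc Qc by (simp add: assoc)
    then show ?thesis using stiefel_square_right_inverse[OF Us] stiefel_square_right_inverse[OF Vs] Qc by simp
  qed
  \<comment> \<open>The candidates for the maximizers; each attains the bound \<open>\<Sum>i. d i\<close>.\<close>
  let ?Q = "\<lambda>W. U * id_oplus r (k - r) W * V\<^sup>T"
  have Ws: "id_oplus r (k - r) W \<in> stiefel k k" if "W \<in> stiefel (k - r) (k - r)" for W
    using id_oplus_stiefel_iff[OF stiefelD(1)[OF that], of r] that rk by simp
  have QW: "?Q W \<in> stiefel k k" if "W \<in> stiefel (k - r) (k - r)" for W
    using stiefel_mult[OF stiefel_mult[OF Us Ws[OF that]] stiefel_square_transpose[OF Vs]] .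
  have rotQW: "U\<^sup>T * ?Q W * V = id_oplus r (k - r) W" if "W \<in> stiefel (k - r) (k - r)" for W
  proof -
    have c: "id_oplus r (k - r) W \<in> carrier_mat k k" by (rule stiefelD(1)[OF Ws[OF that]])
    have "U\<^sup>T * ?Q W * V = (U\<^sup>T * U) * id_oplus r (k - r) W * (V\<^sup>T * V)"
      using Uc Vc c by (simp add: assoc)
    then show ?thesis using stiefelD(2)[OF Us] stiefelD(2)[OF Vs] left_mult_one_mat[OF c] right_mult_one_mat[OF c]
      by simp
  qed
  have trQW: "mat_trace ((?Q W)\<^sup>T * M) = (\<Sum>i<k. d i)" if "W \<in> stiefel (k - r) (k - r)" for W
    unfolding trM[OF QW[OF that]] rotQW[OF that]
  proof (rule sum.cong)
    fix i assume "i \<in> {..<k}"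
    then show "d i * id_oplus r (k - r) W $$ (i, i) = d i"
      using zero[of i] stiefelD(1)[OF that] by (cases "i < r") auto
  qed simp
  have tr_le: "mat_trace (Q\<^sup>T * M) \<le> (\<Sum>i<k. d i)" if "Q \<in> stiefel k k" for Q
    unfolding trM[OF that] by (rule sum_diagonal_stiefel_le[OF rot[OF that] d_ge])
  have XQW: "X * ?Q W = ?S + ?T W" if "W \<in> stiefel (k - r) (k - r)" for W
  proof -
    note Wc = stiefelD(1)[OF that]
    have c: "?U1 \<in> carrier_mat k r" "?V1 \<in> carrier_mat k r"
      "?U2 \<in> carrier_mat k (k - r)" "?V2 \<in> carrier_mat k (k - r)"
      using cols_range_carrier[OF Uc, of 0 r] cols_range_carrier[OF Vc, of 0 r]
        cols_range_carrier[OF Uc, of r k] cols_range_carrier[OF Vc, of r k] by simp_all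
    have "X * ?Q W = X * (?U1 * ?V1\<^sup>T) + X * (?U2 * W * ?V2\<^sup>T)"
      unfolding mult_id_oplus_mult_transpose[OF Uc Vc rk Wc]
      using Xc c Wc by (intro mult_add_distrib_mat[of _ n k _ k]) auto
    also have "X * (?U1 * ?V1\<^sup>T) = ?S"
      using Xc c by (intro assoc_mult_mat[symmetric]) auto
    also have "X * (?U2 * W * ?V2\<^sup>T) = ?T W"
      using Xc c Wc by (simp add: assoc_mult_mat[of _ n k _ "k - r" _ k]
          assoc_mult_mat[of _ n "k - r" _ "k - r" _ k] assoc_mult_mat[of _ k "k - r" _ "k - r" _ k]
          assoc_mult_mat[of _ n k _ "k - r" _ "k - r"])
    finally show ?thesis .
  qed

  have b: "mat_trace (X\<^sup>T * B * X) powr \<theta> > 0"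
    using mat_trace_quadratic_pos[OF Xs assms(5,6,7)] by simp
  have less_iff: "?c Q < ?c Q' \<longleftrightarrow> mat_trace (Q\<^sup>T * M) < mat_trace (Q'\<^sup>T * M)"
    if "Q \<in> stiefel k k" "Q' \<in> stiefel k k" for Q Q'
    using b that by (simp add: f_theta_mult_orthogonal[OF assms(3,5,8) Xc] M_def[symmetric]
        divide_less_cancel)
  have max_iff: "?maximizer Q \<longleftrightarrow> Q \<in> stiefel k k \<and> mat_trace (Q\<^sup>T * M) = (\<Sum>i<k. d i)" for Q
  proof
    assume max: "?maximizer Q"
    then have Q: "Q \<in> stiefel k k" by (simp add: is_arg_max_def)
    \<comment> \<open>The identity as \<open>W\<close> shows that the bound is attained, so a maximizer has to reach it.\<close>
    have I: "1\<^sub>m (k - r) \<in> stiefel (k - r) (k - r)" by (rule stiefelI) auto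
    have "\<not> ?c Q < ?c (?Q (1\<^sub>m (k - r)))" using max QW[OF I] by (auto simp: is_arg_max_def)
    then have "(\<Sum>i<k. d i) \<le> mat_trace (Q\<^sup>T * M)"
      using less_iff[OF Q QW[OF I]] trQW[OF I] by simp
    then show "Q \<in> stiefel k k \<and> mat_trace (Q\<^sup>T * M) = (\<Sum>i<k. d i)"
      using tr_le[OF Q] Q by simp
  next
    assume "Q \<in> stiefel k k \<and> mat_trace (Q\<^sup>T * M) = (\<Sum>i<k. d i)"
    then show "?maximizer Q"
      using less_iff tr_le by (fastforce simp: is_arg_max_def)
  qed

  have part1: "(\<exists>W \<in> stiefel (k - r) (k - r). X * Q = ?S + ?T W)
      \<and> (X * Q)\<^sup>T * D = V * \<Sigma> * V\<^sup>T
      \<and> psd_mat ((X * Q)\<^sup>T * D)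
      \<and> mat_trace ((X * Q)\<^sup>T * D) = trace_norm (X\<^sup>T * D)" if "?maximizer Q" for Q
  proof -
    have Q: "Q \<in> stiefel k k" and tr: "mat_trace (Q\<^sup>T * M) = (\<Sum>i<k. d i)"
      using that max_iff by auto
    note Qc = stiefelD(1)[OF Q]
    define P where "P = U\<^sup>T * Q * V"
    have Pc: "P \<in> carrier_mat k k" using stiefelD(1)[OF rot[OF Q]] by (simp only: P_def)
    have Q_eq: "Q = U * P * V\<^sup>T" using unrot[OF Q] by (simp only: P_def)
    have "(\<Sum>i<k. d i * P $$ (i, i)) = (\<Sum>i<k. d i)"
      using tr unfolding P_def trM[OF Q] .
    then obtain W where W: "W \<in> stiefel (k - r) (k - r)" and P: "P = id_oplus r (k - r) W"
      using sum_diagonal_stiefel_eq_imp_id_oplus[where d = d and s = r, OF rot[OF Q, folded P_def] d_ge rk pos]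
      by blast
    have XQD: "(X * Q)\<^sup>T * D = Q\<^sup>T * M"
      unfolding M_def transpose_mult[OF Xc Qc] using Xc Qc assms(8) by (intro assoc_mult_mat) auto
    have P\<Sigma>: "P\<^sup>T * \<Sigma> = \<Sigma>"
    proof -
      have "\<Sigma> * P = \<Sigma>"
        unfolding \<Sigma> diagonal_mult[OF Pc] unfolding P
        using zero stiefelD(1)[OF W] rk by (intro eq_matI) (auto simp: diagonal_def)
      moreover have "\<Sigma>\<^sup>T = \<Sigma>" unfolding \<Sigma> by (intro eq_matI) (auto simp: diagonal_def)
      ultimately show ?thesis using transpose_mult[OF \<Sigma>c Pc] by simp
    qed
    have "Q\<^sup>T = V * P\<^sup>T * U\<^sup>T"
      unfolding Q_eq using transpose_mult_mult[OF Uc Pc, of "V\<^sup>T" k] Uc Vc Pc by (simp add: assoc)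
    then have "Q\<^sup>T * M = V * (P\<^sup>T * ((U\<^sup>T * U) * (\<Sigma> * V\<^sup>T)))"
      unfolding M using Uc Vc Pc \<Sigma>c by (simp add: assoc)
    also have "\<dots> = V * (P\<^sup>T * \<Sigma>) * V\<^sup>T"
      using stiefelD(2)[OF Us] Vc Pc \<Sigma>c by (simp add: assoc)
    finally have QM: "Q\<^sup>T * M = V * \<Sigma> * V\<^sup>T" unfolding P\<Sigma> .
    have "psd_mat (V * \<Sigma> * V\<^sup>T)" unfolding \<Sigma> by (rule psd_mat_conj_diagonal[OF Vc d_ge])
    moreover have "trace_norm (X\<^sup>T * D) = (\<Sum>i<k. d i)"
      unfolding M_def[symmetric] M \<Sigma> by (rule trace_norm_svd[OF Us Vs d_ge])
    moreover have "\<exists>W \<in> stiefel (k - r) (k - r). X * Q = ?S + ?T W"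
      using XQW[OF W] W unfolding Q_eq P by (intro bexI[of _ W])
    ultimately show ?thesis using XQD QM tr by simp
  qed
  have U1: "?U1 \<in> stiefel k r" "?V1 \<in> stiefel k r"
    using cols_range_stiefel[OF Us rk, of 0] cols_range_stiefel[OF Vs rk, of 0] by simp_all
  have U2: "?U2 \<in> stiefel k (k - r)" "?V2 \<in> stiefel k (k - r)"
    using cols_range_stiefel[OF Us order_refl, of r] cols_range_stiefel[OF Vs order_refl, of r] by simp_all
  have rankS: "mat_rank ?S = r"
    by (rule mat_rank_stiefel_mult_transpose[OF stiefel_mult[OF Xs U1(1)] U1(2)])
  have rankT: "mat_rank (?T W) = k - r" if "W \<in> stiefel (k - r) (k - r)" for W
    by (rule mat_rank_stiefel_mult_transpose[OF stiefel_mult[OF stiefel_mult[OF Xs U2(1)] that] U2(2)])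
  have part4: "\<exists>Q. ?maximizer Q \<and> X * Q = ?S + ?T W" if "W \<in> stiefel (k - r) (k - r)" for W
    using max_iff QW[OF that] trQW[OF that] XQW[OF that] by blast
  show ?thesis
    unfolding Let_def using part1 rankS rankT part4 by blast
qed

end
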